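(* Let $f_j(z),g_j(z),h_j(z)$ ($j\ge 0$) be the generating functions of skew Dyck paths with catastrophes ending at level $j$ in the up layer, the black-down layer and the red-down layer, respectively, as defined in the context. Put $$r_1=\frac{1+z^2+\sqrt{1-6z^2+5z^4}}{2z},\qquad r_2=\frac{1+z^2-\sqrt{1-6z^2+5z^4}}{2z}.$$ Then for all $j\ge 0$ $$f_j=\frac{f_0}{r_1^{j}},\qquad g_j=(r_2-z)\frac{f_0}{r_1^{j+1}},\qquad h_j=(r_2-2z)\frac{f_0}{r_1^{j+1}},$$ and $$f_0+g_0+h_0=\frac{(1-z^2)(3-z)(1-z-2z^2-z^3)-(1-4z-3z^2+z^3+z^4)\sqrt{1-6z^2+5z^4}}{2(1-2z^2-6z^3-3z^4+z^5+z^6)}.$$ Moreover, the generating function of all paths, regardless of the final level, is $$\sum_{j\ge0}f_j+\sum_{j\ge0}g_j+\sum_{j\ge0}h_j=\frac{(1+z)(1-4z+4z^2+4z^3-z^5)+(1+5z+3z^2-z^3-z^4)\sqrt{1-6z^2+5z^4}}{2(1-2z^2-6z^3-3z^4+z^5+z^6)}.$$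
   Context: Skew Dyck paths are Dyck paths (steps $(1,1)$ and $(1,-1)$, starting at the origin, never going below the $x$-axis) in which a south-west step $(-1,-1)$ is additionally allowed, provided the path does not intersect itself. Equivalently, each step $(-1,-1)$ is replaced by a red down-step $(1,-1)$. The paths then consist of up-steps, black down-steps and red down-steps, where an up-step immediately followed by a red down-step, and a red down-step immediately followed by an up-step, are forbidden. A catastrophe is a single step leading from any level $i\ge 2$ directly to the origin state (level $0$, up layer). Precisely, a skew Dyck path with catastrophes is a walk in the following directed graph. The states are $U_i,B_i,R_i$ for $i\ge 0$, where $i$ is the level and $U$, $B$, $R$ are the up layer, the black-down layer and the red-down layer. The walk starts at $U_0$. The edges are, for all $i\ge0$: - up-steps $U_i\to U_{i+1}$ and $B_i\to U_{i+1}$; - black down-steps $U_{i+1}\to B_i$, $B_{i+1}\to B_i$ and $R_{i+1}\to B_i$; - red down-steps $B_{i+1}\to R_i$ and $R_{i+1}\to R_i$; and, for all $i\ge 2$, the catastrophes $U_i\to U_0$, $B_i\to U_0$ and $R_i\to U_0$. Every edge counts as one step. The coefficient of $z^n$ in $f_j=f_j(z)$, $g_j=g_j(z)$, $h_j=h_j(z)$ is the number of walks of exactly $n$ steps from $U_0$ to $U_j$, $B_j$, $R_j$, respectively. Equivalently, these are the formal power series satisfying $$f_0=1+z\sum_{i\ge2}f_i+z\sum_{i\ge2}g_i+z\sum_{i\ge2}h_i,$$ and, for all $i\ge 0$, $$f_{i+1}=zf_i+zg_i,\qquad g_i=zf_{i+1}+zg_{i+1}+zh_{i+1},\qquad h_i=zh_{i+1}+zg_{i+1}.$$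 Here $\sqrt{1-6z^2+5z^4}$ denotes the formal power series square root with constant term $1$. Thus $r_1$ is a formal Laurent series with leading term $1/z$, and $1/r_1$ and $r_2$ are formal power series in $z$. All identities are identities of formal (Laurent) series. *)

theory Defs
  imports "HOL-Computational_Algebra.Formal_Laurent_Series"
begin

datatype state = U nat | B nat | R nat

inductive edge :: "state \<Rightarrow> state \<Rightarrow> bool" where
  up_U: "edge (U i) (U (i + 1))"
| up_B: "edge (B i) (U (i + 1))"
| black_U: "edge (U (i + 1)) (B i)"
| black_B: "edge (B (i + 1)) (B i)"
| black_R: "edge (R (i + 1)) (B i)"
| red_B: "edge (B (i + 1)) (R i)"
| red_R: "edge (R (i + 1)) (R i)"
| cat_U: "i \<ge> 2 \<Longrightarrow> edge (U i) (U 0)"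
| cat_B: "i \<ge> 2 \<Longrightarrow> edge (B i) (U 0)"
| cat_R: "i \<ge> 2 \<Longrightarrow> edge (R i) (U 0)"

text \<open>A walk is represented by the list of the states it visits. This loses nothing, because no two
  different steps connect the same ordered pair of states.\<close>

definition walks :: "nat \<Rightarrow> state list set" where
  "walks n = {w. length w = n + 1 \<and> hd w = U 0 \<and> successively edge w}"

definition walks_to :: "nat \<Rightarrow> state \<Rightarrow> state list set" where
  "walks_to n t = {w \<in> walks n. last w = t}"

text \<open>All walk sets are finite, so that \<^const>\<open>card\<close> counts them.\<close>

lemma walks_0: "walks 0 = {[U 0]}"
  by (auto simp: walks_def length_Suc_conv)

lemma finite_successors: "finite {t. edge s t}"
proof -
  obtain i where i: "s = U i \<or> s = B i \<or> s = R i"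
    by (cases s) auto
  have "{t. edge s t} \<subseteq> {U (i + 1), B (i - 1), R (i - 1), U 0}"
    using i by (auto elim: edge.cases)
  then show ?thesis
    by (rule finite_subset) simp
qed

lemma walks_Suc: "walks (Suc n) \<subseteq> (\<Union>w\<in>walks n. (\<lambda>t. w @ [t]) ` {t. edge (last w) t})"
proof
  fix w assume w: "w \<in> walks (Suc n)"
  then obtain v t where vt: "w = v @ [t]"
    by (cases w rule: rev_cases) (auto simp: walks_def)
  with w have "v \<noteq> []"
    by (auto simp: walks_def)
  with w vt have "v \<in> walks n" "edge (last v) t"
    by (auto simp: walks_def successively_append_iff)
  with vt show "w \<in> (\<Union>w\<in>walks n. (\<lambda>t. w @ [t]) ` {t. edge (last w) t})"
    by auto
qed

lemma finite_walks: "finite (walks n)"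
proof (induction n)
  case 0
  show ?case by (simp add: walks_0)
next
  case (Suc n)
  then show ?case
    by (intro finite_subset[OF walks_Suc] finite_UN_I finite_imageI finite_successors)
qed

lemma finite_walks_to: "finite (walks_to n t)"
  by (simp add: walks_to_def finite_walks)

definition state_gf :: "state \<Rightarrow> real fps" where
  "state_gf t = Abs_fps (\<lambda>n. of_nat (card (walks_to n t)))"

definition all_gf :: "real fps" where
  "all_gf = Abs_fps (\<lambda>n. of_nat (card (walks n)))"

definition sqrt_disc :: "real fps" where
  "sqrt_disc = fps_radical root 2 (1 - 6 * fps_X ^ 2 + 5 * fps_X ^ 4)"

lemma sqrt_disc_nth_0: "fps_nth sqrt_disc 0 = 1"
  by (simp add: sqrt_disc_def numeral_2_eq_2)

lemma sqrt_disc_square: "sqrt_disc ^ 2 = 1 - 6 * fps_X ^ 2 + 5 * fps_X ^ 4"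
proof -
  let ?P = "1 - 6 * fps_X ^ 2 + 5 * fps_X ^ 4 :: real fps"
  have "fps_nth ?P 0 = 1"
    by simp
  then show ?thesis
    using power_radical[of ?P root 1] by (simp add: sqrt_disc_def numeral_2_eq_2)
qed

definition r1 :: "real fls" where
  "r1 = (1 + fls_X ^ 2 + fps_to_fls sqrt_disc) / (2 * fls_X)"

definition r2 :: "real fls" where
  "r2 = (1 + fls_X ^ 2 - fps_to_fls sqrt_disc) / (2 * fls_X)"

end

theory Submission
  imports Defs
begin

text \<open>
  Write \<open>z\<close> for the indeterminate and \<open>w = 1 / r1\<close>. Looking at the last step of a walk turns the edges
  into linear equations. All equations but the one for \<open>f\<^sub>0\<close> are those of a graph without
  catastrophes, and since every edge contributes a factor \<open>z\<close>, they determine all the series once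
  \<open>f\<^sub>0\<close> is given (\<open>layer_system_unique\<close>). So it is enough to exhibit one solution. The ansatz
  \<open>f\<^sub>j = f\<^sub>0 w\<^sup>j\<close>, with \<open>g\<^sub>j\<close> and \<open>h\<^sub>j\<close> also geometric of ratio \<open>w\<close>, solves them exactly when \<open>w\<close> is a
  root of the kernel \<open>z (2 - z\<^sup>2) w\<^sup>2 - (1 + z\<^sup>2) w + z\<close>. The discriminant of the kernel is
  \<open>1 - 6 z\<^sup>2 + 5 z\<^sup>4\<close>, and its root with vanishing constant coefficient is \<open>1 / r1\<close>, because
  \<open>r1 r2 = 2 - z\<^sup>2\<close> and \<open>r1 + r2 = (1 + z\<^sup>2) / z\<close>.

  What remains is \<open>f\<^sub>0\<close>. Any state on level at least 2 has a catastrophe, and no other edge enters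
  \<open>U 0\<close>; hence \<open>f\<^sub>0 = 1 + z (T - L\<^sub>0 - L\<^sub>1)\<close>, where \<open>T\<close> counts all walks and \<open>L\<^sub>i\<close> those that end on level \<open>i\<close>
  (\<open>state_gf_origin\<close>). The levels are geometric, so \<open>L\<^sub>1 = w L\<^sub>0\<close> and \<open>T = L\<^sub>0 / (1 - w)\<close>. Together with
  \<open>z L\<^sub>0 = f\<^sub>0 (r2 - z)\<close> this is a linear equation for \<open>f\<^sub>0\<close>, and modulo the kernel its solution becomes
  \<open>T = (r2 - z) / (z - w\<^sup>2)\<close> and \<open>L\<^sub>0 = (1 - w) (r2 - z) / (z - w\<^sup>2)\<close> (\<open>gf_kernel_root\<close>). The stated closed forms are
  these two quotients with \<open>w\<close> expressed by the square root and the denominator made rational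
  (\<open>gf_times_denominator\<close>).

  The algebra is done with power series, in which \<open>w\<close> and \<open>r2\<close> live; only the final comparison with
  \<open>r1\<close> needs Laurent series.
\<close>

section \<open>Counting walks by their last step\<close>

lemma walks_to_Suc_eq: "walks_to (Suc n) t = (\<lambda>w. w @ [t]) ` {w \<in> walks n. edge (last w) t}"
proof
  show "walks_to (Suc n) t \<subseteq> (\<lambda>w. w @ [t]) ` {w \<in> walks n. edge (last w) t}"
    using walks_Suc[of n] by (auto simp: walks_to_def)
next
  show "(\<lambda>w. w @ [t]) ` {w \<in> walks n. edge (last w) t} \<subseteq> walks_to (Suc n) t"
    by (auto simp: walks_to_def walks_def successively_append_iff hd_append)
qed

lemma card_walks_to_Suc: "card (walks_to (Suc n) t) = card {w \<in> walks n. edge (last w) t}"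
  unfolding walks_to_Suc_eq by (rule card_image) (auto simp: inj_on_def)

lemma card_walks_last_in:
  assumes "finite P"
  shows "card {w \<in> walks n. last w \<in> P} = (\<Sum>s\<in>P. card (walks_to n s))"
proof -
  have "{w \<in> walks n. last w \<in> P} = (\<Union>s\<in>P. walks_to n s)"
    by (auto simp: walks_to_def)
  also have "card \<dots> = (\<Sum>s\<in>P. card (walks_to n s))"
    using assms by (intro card_UN_disjoint) (auto simp: finite_walks_to, auto simp: walks_to_def)
  finally show ?thesis .
qed

lemma walks_to_0: "walks_to 0 t = (if t = U 0 then {[U 0]} else {})"
  by (auto simp: walks_to_def walks_0)

lemma state_gf_finite_predecessors:
  assumes "finite P" and "\<And>s. edge s t \<longleftrightarrow> s \<in> P" and "t \<noteq> U 0"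
  shows "state_gf t = fps_X * (\<Sum>s\<in>P. state_gf s)"
proof (rule fps_ext)
  fix n
  show "fps_nth (state_gf t) n = fps_nth (fps_X * (\<Sum>s\<in>P. state_gf s)) n"
  proof (cases n)
    case 0
    then show ?thesis using assms(3) by (simp add: state_gf_def walks_to_0)
  next
    case (Suc m)
    then show ?thesis
      using assms(1,2)
      by (simp add: state_gf_def card_walks_to_Suc card_walks_last_in fps_sum_nth)
  qed
qed

lemma edge_to_U_Suc: "edge s (U (Suc i)) \<longleftrightarrow> s \<in> {U i, B i}"
  by (auto elim: edge.cases intro: up_U[of i, simplified] up_B[of i, simplified])

lemma edge_to_B: "edge s (B i) \<longleftrightarrow> s \<in> {U (Suc i), B (Suc i), R (Suc i)}"
  by (auto elim: edge.cases
      intro: black_U[of i, simplified] black_B[of i, simplified] black_R[of i, simplified])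

lemma edge_to_R: "edge s (R i) \<longleftrightarrow> s \<in> {B (Suc i), R (Suc i)}"
  by (auto elim: edge.cases intro: red_B[of i, simplified] red_R[of i, simplified])

lemma edge_to_origin: "edge s (U 0) \<longleftrightarrow> s \<notin> {U 0, U 1, B 0, B 1, R 0, R 1}"
  by (cases s) (auto simp: edge.simps)

text \<open>The origin has infinitely many predecessors, but only the six states on levels \<open>0\<close> and \<open>1\<close>
  are missing from them; counting the complement avoids an infinite sum.\<close>

lemma state_gf_origin:
  "state_gf (U 0) = 1 + fps_X * (all_gf - (\<Sum>s\<in>{U 0, U 1, B 0, B 1, R 0, R 1}. state_gf s))"
proof (rule fps_ext)
  fix n
  let ?P = "{U 0, U 1, B 0, B 1, R 0, R 1}"
  show "fps_nth (state_gf (U 0)) n = fps_nth (1 + fps_X * (all_gf - (\<Sum>s\<in>?P. state_gf s))) n"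
  proof (cases n)
    case 0
    then show ?thesis by (simp add: state_gf_def walks_to_0)
  next
    case (Suc m)
    have "card {w \<in> walks m. edge (last w) (U 0)} = card (walks m - {w \<in> walks m. last w \<in> ?P})"
      by (rule arg_cong[of _ _ card]) (auto simp only: edge_to_origin)
    also have "\<dots> = card (walks m) - card {w \<in> walks m. last w \<in> ?P}"
      by (rule card_Diff_subset) (auto simp: finite_walks)
    finally have "real (card {w \<in> walks m. edge (last w) (U 0)})
        = real (card (walks m)) - real (card {w \<in> walks m. last w \<in> ?P})"
      by (simp add: of_nat_diff card_mono finite_walks)
    also have "card {w \<in> walks m. last w \<in> ?P} = (\<Sum>s\<in>?P. card (walks_to m s))"
      by (rule card_walks_last_in) simp
    finally show ?thesis
      by (simp add: Suc state_gf_def all_gf_def card_walks_to_Suc fps_sum_nth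
          del: sum.insert insert_iff)
  qed
qed

fun level :: "state \<Rightarrow> nat" where
  "level (U i) = i" | "level (B i) = i" | "level (R i) = i"

lemma level_edge: "edge s t \<Longrightarrow> level t \<le> Suc (level s)"
  by (induction rule: edge.induct) auto

lemma level_last_walk: "w \<in> walks n \<Longrightarrow> level (last w) \<le> n"
proof (induction n arbitrary: w)
  case 0
  then show ?case by (simp add: walks_0)
next
  case (Suc n)
  then obtain v t where "v \<in> walks n" "edge (last v) t" "w = v @ [t]"
    using walks_Suc[of n] by auto
  with Suc.IH[of v] level_edge[of "last v" t] show ?case
    by simp
qed

lemma state_gf_nth_eq_0: "n < level t \<Longrightarrow> fps_nth (state_gf t) n = 0"
  using level_last_walk[of _ n] by (force simp: state_gf_def walks_to_def finite_walks)

lemma all_gf_nth: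
  "fps_nth all_gf n = (\<Sum>j\<le>n. fps_nth (state_gf (U j)) n) + (\<Sum>j\<le>n. fps_nth (state_gf (B j)) n)
     + (\<Sum>j\<le>n. fps_nth (state_gf (R j)) n)"
proof -
  let ?P = "U ` {..n} \<union> B ` {..n} \<union> R ` {..n}"
  have "last w \<in> ?P" if "w \<in> walks n" for w
    using level_last_walk[OF that] by (cases "last w") auto
  then have "card (walks n) = card {w \<in> walks n. last w \<in> ?P}"
    by (intro arg_cong[of _ _ card]) blast
  also have "\<dots> = (\<Sum>s\<in>?P. card (walks_to n s))"
    by (rule card_walks_last_in) simp
  also have "\<dots> = (\<Sum>j\<le>n. card (walks_to n (U j))) + (\<Sum>j\<le>n. card (walks_to n (B j)))
      + (\<Sum>j\<le>n. card (walks_to n (R j)))"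
    by (subst sum.union_disjoint; (subst sum.union_disjoint)?) (auto simp: sum.reindex inj_on_def)
  finally show ?thesis
    by (simp add: all_gf_def state_gf_def)
qed

section \<open>The layer system determines its solution from the origin\<close>

text \<open>All equations of the generating functions except the one for \<open>f\<^sub>0\<close>, the only one that involves
  catastrophes.\<close>

definition layer_system :: "(nat \<Rightarrow> real fps) \<Rightarrow> (nat \<Rightarrow> real fps) \<Rightarrow> (nat \<Rightarrow> real fps) \<Rightarrow> bool" where
  "layer_system f g h \<longleftrightarrow> (\<forall>i. f (Suc i) = fps_X * (f i + g i)
     \<and> g i = fps_X * (f (Suc i) + g (Suc i) + h (Suc i))
     \<and> h i = fps_X * (g (Suc i) + h (Suc i)))"

lemma layer_system_state_gf:
  "layer_system (\<lambda>j. state_gf (U j)) (\<lambda>j. state_gf (B j)) (\<lambda>j. state_gf (R j))"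
proof -
  have "state_gf (U (Suc i)) = fps_X * (state_gf (U i) + state_gf (B i))"
    "state_gf (B i) = fps_X * (state_gf (U (Suc i)) + state_gf (B (Suc i)) + state_gf (R (Suc i)))"
    "state_gf (R i) = fps_X * (state_gf (B (Suc i)) + state_gf (R (Suc i)))" for i
    using state_gf_finite_predecessors[OF _ edge_to_U_Suc[of _ i]]
      state_gf_finite_predecessors[OF _ edge_to_B[of _ i]]
      state_gf_finite_predecessors[OF _ edge_to_R[of _ i]]
    by (simp_all add: add.assoc)
  then show ?thesis
    unfolding layer_system_def by blast
qed

text \<open>Every right-hand side carries a factor \<open>z\<close>, so the coefficients of order \<open>n + 1\<close> depend only on
  those of order \<open>n\<close>. This replaces a condition for \<open>j \<longrightarrow> \<infinity>\<close>: the geometric sequences with the second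
  root \<open>1 / r2\<close> of the kernel solve the same recurrence, but for large \<open>j\<close> they have poles at \<open>z = 0\<close>.\<close>

lemma layer_system_unique:
  assumes "layer_system f g h" and "layer_system f' g' h'" and "f 0 = f' 0"
  shows "f j = f' j \<and> g j = g' j \<and> h j = h' j"
proof -
  have U: "u (Suc j) = fps_X * (u j + v j)"
    and B: "v j = fps_X * (u (Suc j) + v (Suc j) + w (Suc j))"
    and R: "w j = fps_X * (v (Suc j) + w (Suc j))" if "layer_system u v w" for u v w j
    using that unfolding layer_system_def by blast+
  have "\<forall>j. fps_nth (f j) n = fps_nth (f' j) n \<and> fps_nth (g j) n = fps_nth (g' j) n
      \<and> fps_nth (h j) n = fps_nth (h' j) n" for n
  proof (induction n)
    case 0
    have zero: "fps_nth (fps_X * p) 0 = 0" for p :: "real fps"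
      by simp
    have "fps_nth (f j) 0 = fps_nth (f' j) 0" for j
      using assms(3) U[OF assms(1)] U[OF assms(2)] zero by (cases j) metis+
    then show ?case
      using B[OF assms(1)] B[OF assms(2)] R[OF assms(1)] R[OF assms(2)] zero by metis
  next
    case (Suc n)
    have step: "fps_nth (fps_X * p) (Suc n) = fps_nth p n" for p :: "real fps"
      by simp
    have "fps_nth (f j) (Suc n) = fps_nth (f' j) (Suc n)" for j
    proof (cases j)
      case 0
      then show ?thesis using assms(3) by simp
    next
      case (Suc i)
      show ?thesis
        unfolding Suc U[OF assms(1), of i] U[OF assms(2), of i] step fps_add_nth
        using Suc.IH by simp
    qed
    moreover have "fps_nth (g j) (Suc n) = fps_nth (g' j) (Suc n)" for j
      by (subst B[OF assms(1)], subst B[OF assms(2)]) (simp only: step fps_add_nth Suc.IH)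
    moreover have "fps_nth (h j) (Suc n) = fps_nth (h' j) (Suc n)" for j
      by (subst R[OF assms(1)], subst R[OF assms(2)]) (simp only: step fps_add_nth Suc.IH)
    ultimately show ?case by blast
  qed
  then show ?thesis
    by (simp add: fps_eq_iff)
qed

section \<open>The root of the kernel\<close>

text \<open>This is \<open>1 / r1\<close> as a power series: \<open>r1 r2 = 2 - z\<^sup>2\<close> gives \<open>1 / r1 = r2 / (2 - z\<^sup>2)\<close>, and the division
  by \<open>z\<close> in \<open>r2\<close> is exact, hence a shift.\<close>

definition kernel_root :: "real fps" where
  "kernel_root = fps_shift 1 (1 + fps_X ^ 2 - sqrt_disc) * inverse (2 * (2 - fps_X ^ 2))"

lemma kernel_root_sqrt_disc:
  "2 * fps_X * (2 - fps_X ^ 2) * kernel_root = 1 + fps_X ^ 2 - sqrt_disc"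
proof -
  let ?c = "2 * (2 - fps_X ^ 2) :: real fps"
  have "fps_X * fps_shift 1 (1 + fps_X ^ 2 - sqrt_disc) = 1 + fps_X ^ 2 - sqrt_disc"
    by (rule fps_ext) (simp add: sqrt_disc_nth_0 fps_X_power_nth split: nat.split)
  moreover have "inverse ?c * ?c = 1"
    by (rule inverse_mult_eq_1) simp
  ultimately show ?thesis
    unfolding kernel_root_def by algebra
qed

text \<open>Squaring the square root expressed by \<open>w\<close> gives the kernel times \<open>4 z (2 - z\<^sup>2)\<close>, which can be cancelled.\<close>

lemma kernel_root_eq:
  "fps_X * (2 - fps_X ^ 2) * kernel_root ^ 2 - (1 + fps_X ^ 2) * kernel_root + fps_X = 0"
proof -
  define w where "w = kernel_root"
  have "sqrt_disc = 1 + fps_X ^ 2 - 2 * fps_X * (2 - fps_X ^ 2) * w"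
    using kernel_root_sqrt_disc by (simp add: w_def)
  then have "4 * fps_X * (2 - fps_X ^ 2)
      * (fps_X * (2 - fps_X ^ 2) * w ^ 2 - (1 + fps_X ^ 2) * w + fps_X) = 0"
    using sqrt_disc_square by algebra
  moreover have "(2 - fps_X ^ 2 :: real fps) \<noteq> 0"
    by (auto simp: fps_eq_iff intro!: exI[of _ 0])
  ultimately show ?thesis
    by (simp add: w_def)
qed

lemma kernel_root_nth_0: "fps_nth kernel_root 0 = 0"
  using arg_cong[OF kernel_root_eq, of "\<lambda>p. fps_nth p 0"] by (simp add: mult.assoc)

text \<open>This is the factor \<open>r2 - z\<close> of \<open>g\<^sub>j\<close>, see \<open>r2_minus_X\<close>.\<close>

definition down_factor :: "real fps" where
  "down_factor = (2 - fps_X ^ 2) * kernel_root - fps_X"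

lemma fps_to_fls_X_power [simp]: "fps_to_fls (fps_X ^ n) = (fls_X ^ n :: real fls)"
  by (simp add: fps_to_fls_power)

lemma r1_kernel_root: "r1 * fps_to_fls kernel_root = 1"
proof -
  have "(1 + fps_X ^ 2 + sqrt_disc) * kernel_root = 2 * fps_X"
    using kernel_root_eq kernel_root_sqrt_disc by algebra
  then have "fps_to_fls ((1 + fps_X ^ 2 + sqrt_disc) * kernel_root) = fps_to_fls (2 * fps_X)"
    by (rule arg_cong)
  then show ?thesis
    by (simp add: r1_def fls_times_fps_to_fls)
qed

lemma r2_minus_X: "r2 - fls_X = fps_to_fls down_factor"
proof -
  have "2 * fps_X * (down_factor + fps_X) = 1 + fps_X ^ 2 - sqrt_disc"
    using kernel_root_sqrt_disc unfolding down_factor_def by algebra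
  then have "fps_to_fls (2 * fps_X * (down_factor + fps_X)) = fps_to_fls (1 + fps_X ^ 2 - sqrt_disc)"
    by (rule arg_cong)
  then have "2 * fls_X * (fps_to_fls down_factor + fls_X) = 1 + fls_X ^ 2 - fps_to_fls sqrt_disc"
    by (simp add: fls_times_fps_to_fls)
  then have "r2 = 2 * fls_X * (fps_to_fls down_factor + fls_X) / (2 * fls_X)"
    by (simp add: r2_def)
  then show ?thesis
    by (simp add: diff_eq_eq)
qed

section \<open>Explicit generating functions\<close>

text \<open>Inserting the ansatz into the system and cancelling powers of \<open>w\<close> leaves three equations in \<open>w\<close> and
  \<open>z\<close>, all of which reduce to the kernel equation. The parameter \<open>a\<close> is free because the equation for
  \<open>f\<^sub>0\<close> is left out.\<close>

lemma layer_system_geometric: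
  "layer_system (\<lambda>j. a * kernel_root ^ j) (\<lambda>j. down_factor * (a * kernel_root ^ Suc j))
     (\<lambda>j. (down_factor - fps_X) * (a * kernel_root ^ Suc j))"
proof -
  define w where "w = kernel_root"
  have Q: "fps_X * (2 - fps_X ^ 2) * w ^ 2 - (1 + fps_X ^ 2) * w + fps_X = 0"
    using kernel_root_eq by (simp add: w_def)
  have D: "down_factor = (2 - fps_X ^ 2) * w - fps_X"
    by (simp add: down_factor_def w_def)
  have "w = fps_X * (1 + down_factor * w)"
    "down_factor = fps_X * (1 + down_factor * w + (down_factor - fps_X) * w)"
    "down_factor - fps_X = fps_X * (down_factor * w + (down_factor - fps_X) * w)"
    using Q unfolding D by algebra+
  then have "a * (w * p) = fps_X * (a * p + down_factor * (a * (w * p)))"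
    "down_factor * (a * (w * p)) = fps_X * (a * (w * p) + down_factor * (a * (w * (w * p)))
       + (down_factor - fps_X) * (a * (w * (w * p))))"
    "(down_factor - fps_X) * (a * (w * p)) = fps_X * (down_factor * (a * (w * (w * p)))
       + (down_factor - fps_X) * (a * (w * (w * p))))" for p
    by algebra+
  then show ?thesis
    unfolding layer_system_def w_def[symmetric] power_Suc by blast
qed

lemma state_gf_explicit:
  "state_gf (U j) = state_gf (U 0) * kernel_root ^ j"
  "state_gf (B j) = down_factor * (state_gf (U 0) * kernel_root ^ Suc j)"
  "state_gf (R j) = (down_factor - fps_X) * (state_gf (U 0) * kernel_root ^ Suc j)"
  using layer_system_unique[OF layer_system_state_gf layer_system_geometric[of "state_gf (U 0)"], of j]
  by auto

text \<open>A walk of \<open>n\<close> steps ends on level at most \<open>n\<close>, so the series over the levels have finite coefficient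
  sums; this is the form of convergence that is used.\<close>

lemma sums_fps_coeffwise:
  fixes F :: "nat \<Rightarrow> real fps"
  assumes "\<And>j n. n < j \<Longrightarrow> fps_nth (F j) n = 0"
  shows "F sums Abs_fps (\<lambda>n. \<Sum>j\<le>n. fps_nth (F j) n)"
  unfolding sums_def
proof (rule tendsto_fpsI)
  fix n
  have "fps_nth (\<Sum>j<N. F j) n = (\<Sum>j\<le>n. fps_nth (F j) n)" if "N > n" for N
    unfolding fps_sum_nth using that assms by (intro sum.mono_neutral_right) auto
  then show "\<forall>\<^sub>F N in sequentially. fps_nth (\<Sum>j<N. F j) n
      = fps_nth (Abs_fps (\<lambda>n. \<Sum>j\<le>n. fps_nth (F j) n)) n"
    by (intro eventually_mono[OF eventually_gt_at_top[of n]]) simp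
qed

lemma sums_fps_geometric:
  fixes a w :: "real fps"
  assumes "fps_nth w 0 = 0"
  shows "(\<lambda>j. a * w ^ j) sums (a * inverse (1 - w))"
  unfolding sums_def
proof (rule tendsto_fpsI)
  fix n
  have inv: "inverse (1 - w) * (1 - w) = 1"
    using assms by (intro inverse_mult_eq_1) simp
  have "fps_nth (\<Sum>j<N. a * w ^ j) n = fps_nth (a * inverse (1 - w)) n" if "N > n" for N
  proof -
    have "(1 - w) * (\<Sum>j<N. w ^ j) = 1 - w ^ N"
      by (simp add: one_diff_power_eq)
    then have "(\<Sum>j<N. w ^ j) = inverse (1 - w) * (1 - w ^ N)"
      using inv by (metis mult.assoc mult.left_neutral)
    then have "(\<Sum>j<N. a * w ^ j) = a * inverse (1 - w) - (a * inverse (1 - w)) * w ^ N"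
      by (simp only: sum_distrib_left[symmetric] right_diff_distrib mult.assoc mult_1_right)
    moreover have "fps_nth ((a * inverse (1 - w)) * w ^ N) n = 0"
      using that startsby_zero_power_prefix[OF assms, of N] by (simp add: fps_mult_nth)
    ultimately show ?thesis by simp
  qed
  then show "\<forall>\<^sub>F N in sequentially. fps_nth (\<Sum>j<N. a * w ^ j) n = fps_nth (a * inverse (1 - w)) n"
    by (intro eventually_mono[OF eventually_gt_at_top[of n]]) simp
qed

lemma summable_state_gf:
  "summable (\<lambda>j. state_gf (U j))" "summable (\<lambda>j. state_gf (B j))" "summable (\<lambda>j. state_gf (R j))"
  by (auto intro!: sums_summable[OF sums_fps_coeffwise] simp: state_gf_nth_eq_0)

lemma all_gf_suminf:
  "all_gf = (\<Sum>j. state_gf (U j)) + (\<Sum>j. state_gf (B j)) + (\<Sum>j. state_gf (R j))"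
proof -
  have "(\<Sum>j. state_gf (l j)) = Abs_fps (\<lambda>n. \<Sum>j\<le>n. fps_nth (state_gf (l j)) n)"
    if "l \<in> {U, B, R}" for l
    using that
    by (intro sums_unique[symmetric] sums_fps_coeffwise) (auto simp: state_gf_nth_eq_0)
  then show ?thesis
    by (intro fps_ext) (simp add: all_gf_nth)
qed

text \<open>The layer system at level 0 reads \<open>g\<^sub>0 = z L\<^sub>1\<close> with \<open>L\<^sub>1 = w L\<^sub>0\<close>, and the geometric solution has
  \<open>g\<^sub>0 = (r2 - z) f\<^sub>0 w\<close>; cancelling \<open>w\<close> gives the identity. In the proof the kernel equation replaces the
  cancellation.\<close>

lemma level_0_gf:
  "fps_X * (state_gf (U 0) + state_gf (B 0) + state_gf (R 0)) = state_gf (U 0) * down_factor"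
proof -
  define w where "w = kernel_root"
  have "fps_X * (2 - fps_X ^ 2) * w ^ 2 - (1 + fps_X ^ 2) * w + fps_X = 0"
    "down_factor = (2 - fps_X ^ 2) * w - fps_X"
    using kernel_root_eq by (simp_all add: down_factor_def w_def)
  then have "fps_X * (f + down_factor * (f * w) + (down_factor - fps_X) * (f * w)) = f * down_factor" for f
    by algebra
  moreover have "state_gf (B 0) = down_factor * (state_gf (U 0) * w)"
    "state_gf (R 0) = (down_factor - fps_X) * (state_gf (U 0) * w)"
    using state_gf_explicit(2,3)[of 0] by (simp_all add: w_def)
  ultimately show ?thesis
    by simp
qed

lemma all_gf_geometric:
  "(1 - kernel_root) * all_gf = state_gf (U 0) + state_gf (B 0) + state_gf (R 0)"
proof -
  define w where "w = kernel_root"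
  have geo: "(\<Sum>j. state_gf (l j)) = state_gf (l 0) * inverse (1 - w)" if "l \<in> {U, B, R}" for l
  proof -
    have "state_gf (l j) = state_gf (l 0) * w ^ j" for j
      using that state_gf_explicit(1)[of j] state_gf_explicit(2)[of j] state_gf_explicit(3)[of j]
        state_gf_explicit(2)[of 0] state_gf_explicit(3)[of 0]
      by (auto simp: w_def mult_ac)
    then have "(\<Sum>j. state_gf (l j)) = (\<Sum>j. state_gf (l 0) * w ^ j)"
      by (rule suminf_cong)
    also have "\<dots> = state_gf (l 0) * inverse (1 - w)"
      by (intro sums_unique[symmetric] sums_fps_geometric) (simp add: w_def kernel_root_nth_0)
    finally show ?thesis .
  qed
  have "inverse (1 - w) * (1 - w) = 1"
    by (rule inverse_mult_eq_1) (simp add: w_def kernel_root_nth_0)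
  then have "(1 - w) * (u * inverse (1 - w)) = u" for u
    by (simp add: mult_ac)
  then show ?thesis
    unfolding all_gf_suminf w_def[symmetric] by (simp only: geo insertI1 insertI2 distrib_left)
qed

text \<open>The equation of the origin determines \<open>f\<^sub>0\<close>. Its denominator \<open>1 - w - w\<^sup>2 (r2 - z)\<close> is
  \<open>(z - w\<^sup>2) / z\<close> modulo the kernel, which is why \<open>z - w\<^sup>2\<close> appears.\<close>

lemma gf_kernel_root:
  "(fps_X - kernel_root ^ 2) * all_gf = down_factor"
  "(fps_X - kernel_root ^ 2) * (state_gf (U 0) + state_gf (B 0) + state_gf (R 0))
     = (1 - kernel_root) * down_factor"
proof -
  define w where "w = kernel_root"
  define f where "f = state_gf (U 0)"
  define l where "l = state_gf (U 0) + state_gf (B 0) + state_gf (R 0)"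
  have Q: "fps_X * (2 - fps_X ^ 2) * w ^ 2 - (1 + fps_X ^ 2) * w + fps_X = 0"
    and D: "down_factor = (2 - fps_X ^ 2) * w - fps_X"
    using kernel_root_eq by (simp_all add: down_factor_def w_def)
  have l: "fps_X * l = f * down_factor"
    using level_0_gf by (simp add: l_def f_def)
  have T: "(1 - w) * all_gf = l"
    using all_gf_geometric by (simp add: l_def w_def)
  have "state_gf (U 1) = w * state_gf (U 0)" "state_gf (B 1) = w * state_gf (B 0)"
    "state_gf (R 1) = w * state_gf (R 0)"
    using state_gf_explicit(1)[of 1] state_gf_explicit(2)[of 1] state_gf_explicit(3)[of 1]
      state_gf_explicit(2)[of 0] state_gf_explicit(3)[of 0]
    by (auto simp: w_def mult_ac)
  then have levels_0_1: "(\<Sum>s\<in>{U 0, U 1, B 0, B 1, R 0, R 1}. state_gf s) = (1 + w) * l"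
    by (simp add: l_def algebra_simps)
  \<comment> \<open>Eliminating \<open>all_gf\<close> and \<open>l\<close>, after multiplication by \<open>1 - w\<close>, leaves \<open>f\<close> as the only unknown.\<close>
  have "f = 1 + fps_X * (all_gf - (1 + w) * l)"
    unfolding f_def levels_0_1[symmetric] by (rule state_gf_origin)
  then have "f * (1 - w - w ^ 2 * down_factor) = 1 - w"
    using l T by algebra
  moreover have "fps_X * (1 - w - w ^ 2 * down_factor) = fps_X - w ^ 2"
    using Q unfolding D by algebra
  ultimately have f: "f * (fps_X - w ^ 2) = fps_X * (1 - w)"
    by algebra
  have "1 - w \<noteq> 0"
    using kernel_root_nth_0 by (auto simp: w_def fps_eq_iff intro!: exI[of _ 0])
  moreover have "fps_X * (1 - w) * ((fps_X - w ^ 2) * all_gf - down_factor) = 0"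
    using l T f by algebra
  ultimately show *: "(fps_X - kernel_root ^ 2) * all_gf = down_factor"
    by (simp add: w_def)
  show "(fps_X - kernel_root ^ 2) * (state_gf (U 0) + state_gf (B 0) + state_gf (R 0))
     = (1 - kernel_root) * down_factor"
    unfolding l_def[symmetric] T[symmetric] *[symmetric] w_def by (rule mult.left_commute)
qed

lemma fps_X_minus_kernel_root_square_neq_0: "fps_X - kernel_root ^ 2 \<noteq> 0"
proof -
  have "fps_nth (fps_X - kernel_root ^ 2) 1 = 1"
    using startsby_zero_power_prefix[OF kernel_root_nth_0, of 2] by simp
  then show ?thesis by auto
qed

text \<open>The factor \<open>z - w\<^sup>2\<close> is nonzero, so each identity may be multiplied by it. By \<open>gf_kernel_root\<close>, both
  sides are then polynomials in \<open>z\<close> and \<open>w\<close>, and their difference is divisible by the kernel.\<close>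

lemma gf_times_denominator:
  defines "z \<equiv> (fps_X :: real fps)"
  defines "d \<equiv> 2 * (1 - 2 * z^2 - 6 * z^3 - 3 * z^4 + z^5 + z^6)"
  shows "(state_gf (U 0) + state_gf (B 0) + state_gf (R 0)) * d
      = (1 - z^2) * (3 - z) * (1 - z - 2 * z^2 - z^3) - (1 - 4 * z - 3 * z^2 + z^3 + z^4) * sqrt_disc"
    and "all_gf * d
      = (1 + z) * (1 - 4 * z + 4 * z^2 + 4 * z^3 - z^5) + (1 + 5 * z + 3 * z^2 - z^3 - z^4) * sqrt_disc"
proof -
  define w where "w = kernel_root"
  define Q where "Q = z * (2 - z ^ 2) * w ^ 2 - (1 + z ^ 2) * w + z"
  have Q: "Q = 0"
    using kernel_root_eq by (simp add: w_def z_def Q_def)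
  have s: "sqrt_disc = 1 + z^2 - 2 * z * (2 - z^2) * w"
    using kernel_root_sqrt_disc by (simp add: w_def z_def)
  have D: "down_factor = (2 - z^2) * w - z"
    by (simp add: down_factor_def w_def z_def)
  have cancel: "p = q" if "(z - w^2) * (p - q) = 0" for p q
    using that fps_X_minus_kernel_root_square_neq_0 by (simp add: z_def w_def)
  show "(state_gf (U 0) + state_gf (B 0) + state_gf (R 0)) * d
      = (1 - z^2) * (3 - z) * (1 - z - 2 * z^2 - z^3) - (1 - 4 * z - 3 * z^2 + z^3 + z^4) * sqrt_disc"
    (is "?l * d = ?n")
  proof (rule cancel)
    \<comment> \<open>The cofactors of \<open>Q\<close>, here and below, are the quotients of polynomial division in \<open>w\<close>.\<close>
    have "(1 - w) * ((2 - z^2) * w - z) * d - (z - w^2) * ?n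
        = (2 * w * (1 - 4*z - 3*z^2 + z^3 + z^4) - 4 + 10*z^2 + 6*z^3 - 2*z^4 - 2*z^5) * Q"
      unfolding s Q_def d_def by algebra
    then show "(z - w^2) * (?l * d - ?n) = 0"
      using gf_kernel_root(2) unfolding Q D z_def[symmetric] w_def[symmetric] by algebra
  qed
  show "all_gf * d
      = (1 + z) * (1 - 4 * z + 4 * z^2 + 4 * z^3 - z^5) + (1 + 5 * z + 3 * z^2 - z^3 - z^4) * sqrt_disc"
    (is "?l * d = ?n")
  proof (rule cancel)
    have "((2 - z^2) * w - z) * d - (z - w^2) * ?n
        = (- 2 * w * (1 + 5*z + 3*z^2 - z^3 - z^4) - 4 - 2*z) * Q"
      unfolding s Q_def d_def by algebra
    then show "(z - w^2) * (?l * d - ?n) = 0"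
      using gf_kernel_root(1) unfolding Q D z_def[symmetric] w_def[symmetric] by algebra
  qed
qed

lemma fps_to_fls_eq_divideI:
  assumes "p * d = n" and "d \<noteq> 0"
  shows "fps_to_fls p = fps_to_fls n / (fps_to_fls d :: real fls)"
  using assms by (auto simp: fls_times_fps_to_fls)

theorem theorem1:
  shows "let z = (fls_X :: real fls);
             s = fps_to_fls sqrt_disc;
             f = (\<lambda>j. state_gf (U j));
             g = (\<lambda>j. state_gf (B j));
             h = (\<lambda>j. state_gf (R j));
             d = 2 * (1 - 2 * z^2 - 6 * z^3 - 3 * z^4 + z^5 + z^6)
         in (\<forall>j. fps_to_fls (f j) = fps_to_fls (f 0) / r1 ^ j
               \<and> fps_to_fls (g j) = (r2 - z) * (fps_to_fls (f 0) / r1 ^ (j + 1))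
               \<and> fps_to_fls (h j) = (r2 - 2 * z) * (fps_to_fls (f 0) / r1 ^ (j + 1)))
          \<and> fps_to_fls (f 0 + g 0 + h 0)
              = ((1 - z^2) * (3 - z) * (1 - z - 2 * z^2 - z^3)
                 - (1 - 4 * z - 3 * z^2 + z^3 + z^4) * s) / d
          \<and> summable f \<and> summable g \<and> summable h
          \<and> all_gf = (\<Sum>j. f j) + (\<Sum>j. g j) + (\<Sum>j. h j)
          \<and> fps_to_fls ((\<Sum>j. f j) + (\<Sum>j. g j) + (\<Sum>j. h j))
              = ((1 + z) * (1 - 4 * z + 4 * z^2 + 4 * z^3 - z^5)
                 + (1 + 5 * z + 3 * z^2 - z^3 - z^4) * s) / d"
proof -
  have inv: "x / r1 ^ k = x * fps_to_fls (kernel_root ^ k)" for x k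
  proof -
    have "fps_to_fls kernel_root = inverse r1"
      using r1_kernel_root by (metis inverse_unique)
    then show ?thesis
      by (simp add: fps_to_fls_power power_inverse divide_inverse)
  qed
  have r2: "r2 - 2 * fls_X = fps_to_fls (down_factor - fps_X)"
    using r2_minus_X by (simp add: algebra_simps)
  have explicit: "fps_to_fls (state_gf (U j)) = fps_to_fls (state_gf (U 0)) / r1 ^ j"
    "fps_to_fls (state_gf (B j)) = (r2 - fls_X) * (fps_to_fls (state_gf (U 0)) / r1 ^ (j + 1))"
    "fps_to_fls (state_gf (R j)) = (r2 - 2 * fls_X) * (fps_to_fls (state_gf (U 0)) / r1 ^ (j + 1))"
    for j
    unfolding inv r2 r2_minus_X fls_times_fps_to_fls[symmetric] using state_gf_explicit[of j] by simp_all
  let ?d = "2 * (1 - 2 * fps_X^2 - 6 * fps_X^3 - 3 * fps_X^4 + fps_X^5 + fps_X^6) :: real fps"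
  have "fps_nth ?d 0 = 2"
    by simp
  then have "?d \<noteq> 0"
    by (metis fps_zero_nth zero_neq_numeral)
  note closed = gf_times_denominator[THEN fps_to_fls_eq_divideI, OF this]
  show ?thesis
    unfolding Let_def all_gf_suminf[symmetric]
    using explicit summable_state_gf
      closed[unfolded fls_times_fps_to_fls fps_to_fls_minus fps_to_fls_plus fps_to_fls_X_power
        fps_X_to_fls fps_to_fls_numeral fps_one_to_fls]
    unfolding fps_to_fls_plus by blast
qed

end
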